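(* Let $J:\mathbb{R}^N\to\mathbb{R}$ be a finite-valued convex function, $\Phi\in\mathbb{R}^{Q\times N}$, $y\in\mathbb{R}^Q$, $\lambda>0$. Let $x$ be a solution of $$(\mathcal P_\lambda(y))\qquad \min_{z\in\mathbb{R}^N}\tfrac12\|y-\Phi z\|^2+\lambda J(z)$$ (respectively, a feasible point of $(\mathcal P_0(y))$: $\min_{z\in\mathbb{R}^N} J(z)$ subject to $\Phi z=y$). Let $T=T_x$, $S=T^\perp$ and $f_x\in\operatorname{ri}\partial J(x)$. If $$\forall\,\delta\in\operatorname{Ker}(\Phi)\setminus\{0\},\qquad \langle e_x,P_T\delta\rangle+\langle P_S f_x,P_S\delta\rangle< J_{f_x}^{x}(-P_S\delta),$$ then $x$ is the unique minimizer of $(\mathcal P_\lambda(y))$ (respectively, of $(\mathcal P_0(y))$).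
   Context: For a finite-valued convex function $J$ on $\mathbb{R}^N$ and $x\in\mathbb{R}^N$: $\bar S_x$ is the affine hull of $\partial J(x)$; $e_x$ is the orthogonal projection of $0$ onto $\bar S_x$; $S_x=\bar S_x-e_x$ (a linear subspace) and $T_x=S_x^\perp$ (the model subspace). $P_V$ is the orthogonal projector onto a subspace $V$; $\operatorname{ri}$ is the relative interior. For a closed convex set $C\ni 0$, its gauge is $\gamma_C(u)=\inf\{\lambda>0:u\in\lambda C\}$ (with $\inf\emptyset=+\infty$), and the gauge polar to $\gamma_C$ is $\gamma_{C^\circ}$, where $C^\circ$ is the polar set; it equals the support function of $C$. The subdifferential gauge is $J_{f_x}^{x,\circ}=\gamma_{\partial J(x)-f_x}$, and $J_{f_x}^{x}$ denotes its polar gauge, i.e. $J_{f_x}^{x}(d)=\sup_{\eta\in\partial J(x)-f_x}\langle\eta,d\rangle$. *)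

theory Defs
  imports "HOL-Analysis.Analysis"
begin

definition subdifferential :: "('a::euclidean_space \<Rightarrow> real) \<Rightarrow> 'a \<Rightarrow> 'a set" where
  "subdifferential J x = {\<eta>. \<forall>z. J z \<ge> J x + \<eta> \<bullet> (z - x)}"

definition e_vec :: "('a::euclidean_space \<Rightarrow> real) \<Rightarrow> 'a \<Rightarrow> 'a" where
  "e_vec J x = closest_point (affine hull (subdifferential J x)) 0"

text \<open>The direction space \<open>S\<^sub>x\<close> of the affine hull of the subdifferential.\<close>

definition dir_space :: "('a::euclidean_space \<Rightarrow> real) \<Rightarrow> 'a \<Rightarrow> 'a set" where
  "dir_space J x = (\<lambda>\<eta>. \<eta> - e_vec J x) ` (affine hull (subdifferential J x))"

definition model_space :: "('a::euclidean_space \<Rightarrow> real) \<Rightarrow> 'a \<Rightarrow> 'a set" where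
  "model_space J x = (dir_space J x)\<^sup>\<bottom>"

text \<open>Minkowski gauge. It takes values in the extended reals, where the infimum of the
  empty set is \<open>\<infinity>\<close>. The name \<open>gauge\<close> is already used in the library for
  Henstock--Kurzweil integration.\<close>

definition minkowski_gauge :: "'a::real_vector set \<Rightarrow> 'a \<Rightarrow> ereal" where
  "minkowski_gauge C u = (INF r\<in>{r::real. 0 < r \<and> u \<in> (\<lambda>c. r *\<^sub>R c) ` C}. ereal r)"

definition polar_set :: "'a::real_inner set \<Rightarrow> 'a set" where
  "polar_set C = {v. \<forall>c\<in>C. c \<bullet> v \<le> 1}"

text \<open>The polar \<open>J\<^bsub>f\<^esub>\<^sup>x\<close> of the subdifferential gauge, that is, of the gauge of the
  translated subdifferential.\<close>

definition subdiff_polar_gauge :: "('a::euclidean_space \<Rightarrow> real) \<Rightarrow> 'a \<Rightarrow> 'a \<Rightarrow> 'a \<Rightarrow> ereal" where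
  "subdiff_polar_gauge J x f d =
     minkowski_gauge (polar_set ((\<lambda>\<eta>. \<eta> - f) ` subdifferential J x)) d"

definition unique_minimizer :: "('a \<Rightarrow> real) \<Rightarrow> ('a \<Rightarrow> bool) \<Rightarrow> 'a \<Rightarrow> bool" where
  "unique_minimizer F P x \<longleftrightarrow> is_arg_min F P x \<and> (\<forall>z. is_arg_min F P z \<longrightarrow> z = x)"

definition penalized_objective ::
    "(real^'n \<Rightarrow> real) \<Rightarrow> real^'n^'q \<Rightarrow> real^'q \<Rightarrow> real \<Rightarrow> real^'n \<Rightarrow> real" where
  "penalized_objective J \<Phi> y lam z = 1 / 2 * (norm (y - \<Phi> *v z))\<^sup>2 + lam * J z"

text \<open>The gauge of the polar set is the support function.\<close>

lemma minkowski_gauge_polar_set: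
  fixes C :: "'a::real_inner set"
  assumes "0 \<in> C"
  shows "minkowski_gauge (polar_set C) u = (SUP c\<in>C. ereal (c \<bullet> u))"
proof -
  have mem: "u \<in> (\<lambda>c. r *\<^sub>R c) ` polar_set C \<longleftrightarrow> (\<forall>c\<in>C. c \<bullet> u \<le> r)" if "0 < r" for r
  proof
    assume "u \<in> (\<lambda>c. r *\<^sub>R c) ` polar_set C"
    then obtain v where v: "u = r *\<^sub>R v" "\<forall>c\<in>C. c \<bullet> v \<le> 1"
      by (auto simp: polar_set_def)
    then show "\<forall>c\<in>C. c \<bullet> u \<le> r"
      using mult_left_mono[of _ 1 r] that by fastforce
  next
    assume "\<forall>c\<in>C. c \<bullet> u \<le> r"
    then have "inverse r *\<^sub>R u \<in> polar_set C"
      using that by (auto simp: polar_set_def field_simps)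
    moreover have "u = r *\<^sub>R (inverse r *\<^sub>R u)" using that by simp
    ultimately show "u \<in> (\<lambda>c. r *\<^sub>R c) ` polar_set C" by blast
  qed
  let ?s = "SUP c\<in>C. ereal (c \<bullet> u)"
  have nonneg: "0 \<le> ?s"
    using SUP_upper[OF assms, of "\<lambda>c. ereal (c \<bullet> u)"] by (simp add: zero_ereal_def)
  have "?s \<le> minkowski_gauge (polar_set C) u"
    unfolding minkowski_gauge_def using mem by (intro INF_greatest SUP_least) auto
  moreover have "minkowski_gauge (polar_set C) u \<le> ?s"
  proof (rule ereal_le_epsilon2)
    fix e :: real assume "0 < e"
    show "minkowski_gauge (polar_set C) u \<le> ?s + ereal e"
    proof (cases "?s")
      case (real s)
      have "0 < s + e" using nonneg real \<open>0 < e\<close> by simp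
      moreover have "c \<bullet> u \<le> s + e" if "c \<in> C" for c
        using SUP_upper[OF that, of "\<lambda>c. ereal (c \<bullet> u)"] real \<open>0 < e\<close> by simp
      ultimately show ?thesis
        unfolding minkowski_gauge_def real using mem by (auto intro!: INF_lower2[of "s + e"])
    qed (use nonneg in auto)
  qed
  ultimately show ?thesis by (rule antisym[rotated])
qed

corollary subdiff_polar_gauge_eq_SUP:
  assumes "f \<in> subdifferential J x"
  shows "subdiff_polar_gauge J x f d
           = (SUP \<eta>\<in>(\<lambda>\<eta>. \<eta> - f) ` subdifferential J x. ereal (\<eta> \<bullet> d))"
  unfolding subdiff_polar_gauge_def
  by (rule minkowski_gauge_polar_set) (use assms in force)

end

theory Submission
  imports Defs
begin

text \<open>
  The hypothesis is a disguised statement about the directional derivative of \<open>J\<close> at \<open>x\<close>.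
  The affine hull of the subdifferential is orthogonal to its point \<open>e\<close> of least norm, so every
  subgradient \<open>\<eta>\<close> splits as \<open>e\<close>, which lies in \<open>T\<close>, plus \<open>\<eta> - e\<close>, which lies in \<open>S\<close>. With this
  splitting the projections disappear: the left-hand side of the hypothesis is
  \<open>f\<^sub>x \<bullet> \<delta>\<close>, and the right-hand side is the supremum of \<open>- (\<eta> - f\<^sub>x) \<bullet> \<delta>\<close> over all subgradients
  \<open>\<eta>\<close>. The strict inequality hence says precisely that some subgradient satisfies
  \<open>\<eta> \<bullet> \<delta> < 0\<close> (lemma \<open>ex_subgradient_inner_neg\<close>).

  Since the kernel of \<open>\<Phi>\<close> is symmetric, the same holds for \<open>- \<delta>\<close>, so along each nonzero kernel
  direction some subgradient has a positive slope, and the subgradient inequality gives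
  \<open>J (x + \<delta>) > J x\<close>. This settles the constrained problem. For the penalized problem, strict
  convexity of the square forces all minimizers to have the same image under \<open>\<Phi>\<close>, and hence the
  same value of \<open>J\<close> (lemma \<open>penalized_minimizers_agree\<close>); two of them therefore differ by a kernel
  direction along which \<open>J\<close> does not grow, which must be zero.
\<close>

text \<open>The obtuse-angle criterion for projections onto convex sets, applied to \<open>a\<close> and to its
  reflection in the projected point, becomes an equality.\<close>

lemma closest_point_affine_orthogonal:
  fixes A :: "'a::euclidean_space set"
  assumes "affine A" and "a \<in> A"
  shows "(d - closest_point A d) \<bullet> (a - closest_point A d) = 0"
proof -
  let ?p = "closest_point A d"
  have A: "convex A" "closed A"
    using assms by (auto simp: affine_imp_convex affine_closed)
  have "?p \<in> A"
    using A assms by (intro closest_point_in_set) auto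
  then have "2 *\<^sub>R ?p + (- 1) *\<^sub>R a \<in> A"
    using assms by (intro mem_affine) auto
  from closest_point_dot[OF A this, of d] closest_point_dot[OF A assms(2), of d]
  show ?thesis
    by (simp add: inner_simps algebra_simps)
qed

lemma inner_closest_point_subspace:
  fixes V :: "'a::euclidean_space set"
  assumes "subspace V" and "v \<in> V"
  shows "v \<bullet> closest_point V d = v \<bullet> d"
proof -
  let ?p = "closest_point V d"
  have "?p \<in> V"
    using assms by (intro closest_point_in_set) (auto simp: closed_subspace)
  then have "?p + v \<in> V"
    using assms by (simp add: subspace_add)
  from closest_point_affine_orthogonal[OF subspace_imp_affine[OF assms(1)] this, of d]
  show ?thesis
    by (simp add: inner_simps inner_commute)
qed

lemma e_vec_in_model_space:
  "e_vec J x \<in> model_space J x"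
proof -
  have "(v - e_vec J x) \<bullet> e_vec J x = 0" if "v \<in> affine hull subdifferential J x" for v
    using closest_point_affine_orthogonal[OF affine_affine_hull that, of 0]
    by (simp add: e_vec_def inner_commute)
  then show ?thesis
    by (auto simp: model_space_def dir_space_def orthogonal_comp_def orthogonal_def)
qed

lemma subgradient_minus_e_vec_in_comp:
  assumes "\<eta> \<in> subdifferential J x"
  shows "\<eta> - e_vec J x \<in> (model_space J x)\<^sup>\<bottom>"
proof -
  have "\<eta> - e_vec J x \<in> dir_space J x"
    using hull_inc[OF assms] by (auto simp: dir_space_def)
  then show ?thesis
    using orthogonal_comp_subset[of "dir_space J x"] by (auto simp: model_space_def)
qed

text \<open>The geometric content of the uniqueness condition for a single direction \<open>\<delta>\<close>: once the
  projections are resolved, \<open>f \<bullet> \<delta>\<close> appears on both sides and cancels, which leaves a condition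
  on the subgradient \<open>\<eta>\<close> alone.\<close>

lemma ex_subgradient_inner_neg:
  fixes J :: "'a::euclidean_space \<Rightarrow> real"
  assumes f: "f \<in> subdifferential J x"
    and T: "T = model_space J x" and S: "S = T\<^sup>\<bottom>"
    and less: "ereal (e_vec J x \<bullet> closest_point T \<delta> + closest_point S f \<bullet> closest_point S \<delta>)
      < subdiff_polar_gauge J x f (- closest_point S \<delta>)"
  shows "\<exists>\<eta>\<in>subdifferential J x. \<eta> \<bullet> \<delta> < 0"
proof -
  let ?e = "e_vec J x" and ?p = "closest_point S \<delta>"
  have subspaces: "subspace T" "subspace S"
    by (simp_all add: T S model_space_def subspace_orthogonal_comp)
  have "?e \<in> T"
    by (simp add: T e_vec_in_model_space)
  have "?p \<in> S"
    using subspaces by (intro closest_point_in_set) (auto simp: closed_subspace dest: subspace_0)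
  have orth: "?e \<bullet> ?p = 0"
    using \<open>?e \<in> T\<close> \<open>?p \<in> S\<close> by (auto simp: S orthogonal_comp_def orthogonal_def)
  have split: "\<eta> \<bullet> ?p = \<eta> \<bullet> \<delta> - ?e \<bullet> \<delta>" if "\<eta> \<in> subdifferential J x" for \<eta>
    using inner_closest_point_subspace[OF subspaces(2), of "\<eta> - ?e" \<delta>]
      subgradient_minus_e_vec_in_comp[OF that] orth
    by (simp add: T S inner_diff_left)
  have "?e \<bullet> closest_point T \<delta> = ?e \<bullet> \<delta>"
    using subspaces(1) \<open>?e \<in> T\<close> by (rule inner_closest_point_subspace)
  moreover have "closest_point S f \<bullet> ?p = f \<bullet> ?p"
    using inner_closest_point_subspace[OF subspaces(2) \<open>?p \<in> S\<close>, of f]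
    by (simp add: inner_commute)
  ultimately have lhs: "?e \<bullet> closest_point T \<delta> + closest_point S f \<bullet> ?p = f \<bullet> \<delta>"
    by (simp add: split[OF f])
  from less obtain \<eta> where \<eta>: "\<eta> \<in> subdifferential J x" "f \<bullet> \<delta> < (\<eta> - f) \<bullet> (- ?p)"
    by (auto simp: lhs subdiff_polar_gauge_eq_SUP[OF f] less_SUP_iff)
  then have "\<eta> \<bullet> \<delta> < 0"
    by (simp add: inner_diff_left split[OF \<eta>(1)] split[OF f])
  with \<eta>(1) show ?thesis ..
qed

text \<open>By the parallelogram identity and the convexity of \<open>J\<close>, the objective at the midpoint of two
  minimizers lies below the common minimal value by at least \<open>(norm (\<Phi> *v (x - z)))\<^sup>2 / 8\<close>, so
  this quantity must vanish.\<close>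

lemma penalized_minimizers_agree:
  fixes J :: "real^'n \<Rightarrow> real"
  assumes "convex_on UNIV J" and "lam > 0"
    and x: "is_arg_min (penalized_objective J \<Phi> y lam) (\<lambda>z. True) x"
    and z: "is_arg_min (penalized_objective J \<Phi> y lam) (\<lambda>z. True) z"
  shows "\<Phi> *v z = \<Phi> *v x" and "J z = J x"
proof -
  let ?F = "penalized_objective J \<Phi> y lam"
  define m where "m = (1 / 2) *\<^sub>R x + (1 / 2) *\<^sub>R z"
  define u where "u = y - \<Phi> *v x"
  define v where "v = y - \<Phi> *v z"
  have eq: "?F x = ?F z" and le: "?F x \<le> ?F m"
    using x z by (auto simp: is_arg_min_linorder intro: antisym)
  have "J m \<le> (1 / 2) * J x + (1 / 2) * J z"
    using convex_onD[OF assms(1), of "1 / 2" x z] by (simp add: m_def)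
  then have J_m: "lam * J m \<le> lam * J x / 2 + lam * J z / 2"
    using mult_left_mono[of "J m" "(1 / 2) * J x + (1 / 2) * J z" lam] assms(2)
    by (simp add: algebra_simps)
  have "y - \<Phi> *v m = (1 / 2) *\<^sub>R u + (1 / 2) *\<^sub>R v"
    by (simp add: m_def u_def v_def matrix_vector_right_distrib matrix_vector_mult_scaleR
        scaleR_diff_right add_diff_add flip: scaleR_left_distrib)
  then have "(norm (y - \<Phi> *v m))\<^sup>2 = (norm u)\<^sup>2 / 2 + (norm v)\<^sup>2 / 2 - (norm (u - v))\<^sup>2 / 4"
    by (simp add: power2_norm_eq_inner inner_simps inner_commute[of v u] add_divide_distrib
        diff_divide_distrib)
  then have "(norm (u - v))\<^sup>2 \<le> 0"
    using eq le J_m unfolding penalized_objective_def u_def[symmetric] v_def[symmetric]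
    by argo
  then show image: "\<Phi> *v z = \<Phi> *v x"
    by (simp add: u_def v_def)
  show "J z = J x"
    using eq assms(2) by (simp add: penalized_objective_def image)
qed

theorem theorem2:
  fixes J :: "real^'n \<Rightarrow> real" and \<Phi> :: "real^'n^'q" and y :: "real^'q"
    and lam :: real and x f\<^sub>x :: "real^'n" and T S :: "(real^'n) set"
  assumes "convex_on UNIV J"
    and "lam > 0"
    and "T = model_space J x" and "S = T\<^sup>\<bottom>"
    and "f\<^sub>x \<in> rel_interior (subdifferential J x)"
    and "\<And>\<delta>. \<Phi> *v \<delta> = 0 \<Longrightarrow> \<delta> \<noteq> 0 \<Longrightarrow>
      ereal (e_vec J x \<bullet> closest_point T \<delta> + closest_point S f\<^sub>x \<bullet> closest_point S \<delta>)
        < subdiff_polar_gauge J x f\<^sub>x (- closest_point S \<delta>)"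
  shows "(is_arg_min (penalized_objective J \<Phi> y lam) (\<lambda>z. True) x \<longrightarrow>
            unique_minimizer (penalized_objective J \<Phi> y lam) (\<lambda>z. True) x) \<and>
         (\<Phi> *v x = y \<longrightarrow> unique_minimizer J (\<lambda>z. \<Phi> *v z = y) x)"
proof -
  have f: "f\<^sub>x \<in> subdifferential J x"
    using assms(5) rel_interior_subset by blast
  have J_less: "J x < J z" if "\<Phi> *v z = \<Phi> *v x" "z \<noteq> x" for z
  proof -
    have "\<Phi> *v (x - z) = 0" "x - z \<noteq> 0"
      using that by (simp_all add: matrix_vector_mult_diff_distrib)
    \<comment> \<open>The condition is used for the direction pointing from \<open>z\<close> back to \<open>x\<close>, since it provides a
      negative slope.\<close>
    from ex_subgradient_inner_neg[OF f assms(3,4) assms(6)[OF this]]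
    obtain \<eta> where "\<eta> \<in> subdifferential J x" "\<eta> \<bullet> (x - z) < 0" ..
    moreover from this(1) have "J z \<ge> J x + \<eta> \<bullet> (z - x)"
      by (simp add: subdifferential_def)
    ultimately show ?thesis
      by (simp add: inner_diff_right)
  qed
  have "unique_minimizer (penalized_objective J \<Phi> y lam) (\<lambda>z. True) x"
    if "is_arg_min (penalized_objective J \<Phi> y lam) (\<lambda>z. True) x"
    unfolding unique_minimizer_def
    using that penalized_minimizers_agree[OF assms(1,2) that] J_less by (metis less_irrefl)
  moreover have "unique_minimizer J (\<lambda>z. \<Phi> *v z = y) x" if "\<Phi> *v x = y"
    unfolding unique_minimizer_def is_arg_min_def
    using that J_less by (metis less_asym less_irrefl)
  ultimately show ?thesis
    by blast
qed

end
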